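(* Let $\mu,\nu\in\Lambda_2(\mathbb{R}^d)$. Then a $2$-optimal L\'evy coupling $\gamma_*$ of $\mu$ and $\nu$ exists; that is, there is $\gamma_*\in\Gamma^\Lambda(\mu,\nu)$ with $$\int_{\mathbb{R}^{2d}}\tfrac12|x-y|^2\,d\gamma_*(x,y)=\inf_{\gamma\in\Gamma^\Lambda(\mu,\nu)}\int_{\mathbb{R}^{2d}}\tfrac12|x-y|^2\,d\gamma(x,y).$$ Moreover, $\gamma_*\in\Lambda_2(\mathbb{R}^{2d})$.
   Context: A L\'evy measure on $\mathbb{R}^n$ is a Borel measure $\mu$ with $\mu(\{0\})=0$ and $\int\min\{1,|x|^2\}\,d\mu<\infty$. $\Lambda_2(\mathbb{R}^n)$ is the set of L\'evy measures with $\int_{\mathbb{R}^n}|x|^2\,d\mu(x)<\infty$. For L\'evy measures $\mu,\nu$ on $\mathbb{R}^d$, $\Gamma^\Lambda(\mu,\nu)$ (the L\'evy couplings) is the set of L\'evy measures $\gamma$ on $\mathbb{R}^{2d}$ such that $\gamma(E\times\mathbb{R}^d)=\mu(E)$ and $\gamma(\mathbb{R}^d\times E)=\nu(E)$ for every Borel set $E\subset\mathbb{R}^d$ disjoint from some neighbourhood of $0$. *)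

theory Defs
  imports "HOL-Analysis.Analysis"
begin

definition levy_measure :: "'a::euclidean_space measure \<Rightarrow> bool" where
  "levy_measure M \<longleftrightarrow>
     sets M = sets borel \<and> emeasure M {0} = 0 \<and>
     (\<integral>\<^sup>+ x. ennreal (min 1 ((norm x)\<^sup>2)) \<partial>M) < \<infinity>"

definition Lambda2 :: "'a::euclidean_space measure set" where
  "Lambda2 = {M. levy_measure M \<and> (\<integral>\<^sup>+ x. ennreal ((norm x)\<^sup>2) \<partial>M) < \<infinity>}"

text \<open>The space of dimension \<open>2 d\<close> is the product type \<open>'a \<times> 'a\<close>; its library norm satisfies
  \<open>(norm (x, y))\<^sup>2 = (norm x)\<^sup>2 + (norm y)\<^sup>2\<close>, i.e. it is the Euclidean norm. The marginal conditions
  are imposed only away from the origin, so the marginals of a coupling on \<open>- {0}\<close> are the given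
  measures, but a coupling may charge \<open>{0} \<times> UNIV\<close> and \<open>UNIV \<times> {0}\<close>.\<close>

definition levy_couplings ::
    "'a::euclidean_space measure \<Rightarrow> 'a measure \<Rightarrow> ('a \<times> 'a) measure set" where
  "levy_couplings M N = {G. levy_measure G \<and>
     (\<forall>E \<in> sets borel. (\<exists>U. open U \<and> 0 \<in> U \<and> E \<inter> U = {}) \<longrightarrow>
        emeasure G (E \<times> UNIV) = emeasure M E \<and>
        emeasure G (UNIV \<times> E) = emeasure N E)}"

definition cost2 :: "('a::euclidean_space \<times> 'a) measure \<Rightarrow> ennreal" where
  "cost2 G = (\<integral>\<^sup>+ (x, y). ennreal (1/2 * (norm (x - y))\<^sup>2) \<partial>G)"

definition optimal_levy_coupling2 ::
    "'a::euclidean_space measure \<Rightarrow> 'a measure \<Rightarrow> ('a \<times> 'a) measure \<Rightarrow> bool" where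
  "optimal_levy_coupling2 M N G \<longleftrightarrow>
     G \<in> levy_couplings M N \<and> cost2 G = (INF G' \<in> levy_couplings M N. cost2 G')"

end

theory Submission
  imports Defs
begin

text \<open>
  The proof is the direct method, with couplings converging on rectangles rather than weakly.

  Take Levy couplings whose costs tend to the infimum. Values of measures lie in the compact space
  \<open>ennreal\<close>, so along a suitable filter their values on \<^emph>\<open>every\<close> set converge
  (\<open>pointwise_limit_along_subfilter\<close>). The limit \<open>m\<close> is finitely additive with the right marginals
  away from the origin. Fixed marginals prevent mass from disappearing, but mass may drift towards the
  axes, where one coordinate vanishes. It stays visible in rectangles \<open>A \<times> B\<close> each of whose sides either
  contains a neighbourhood of \<open>0\<close> or misses one (\<open>origin_regular\<close>). On these rectangles \<open>m\<close> is countably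
  additive by inner and outer regularity of the marginals (\<open>coupling_content_rectangle_subadditive\<close>), hence
  it extends to a measure; after its atom at the origin is removed, this is a Levy coupling
  (\<open>levy_coupling_of_content\<close>).

  The cost is the limit of smaller functions that are constant on finitely many such rectangles
  and vanish near the origin, so its integral is lower semicontinuous
  for this convergence (\<open>cost2_le_limit\<close>), and the coupling obtained is optimal. Second moments of a coupling
  are the sums of those of its marginals (\<open>levy_coupling_Lambda2\<close>), since
  \<open>(norm (x, y))\<^sup>2 = (norm x)\<^sup>2 + (norm y)\<^sup>2\<close>.
\<close>

section \<open>Sets that are regular at the origin\<close>

text \<open>The Borel sets without the origin on their frontier. The two alternatives (the set contains a ball
  around \<open>0\<close>, or it misses one) are what the estimates use, so they serve as the definition.\<close>

definition origin_regular :: "'a::euclidean_space set set" where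
  "origin_regular = {A \<in> sets borel. \<exists>r>0. ball 0 r \<subseteq> A \<or> A \<subseteq> - ball 0 r}"

lemma origin_regular_borel: "A \<in> origin_regular \<Longrightarrow> A \<in> sets borel"
  by (simp add: origin_regular_def)

lemma origin_regularI:
  assumes "A \<in> sets borel" "r > 0" "ball 0 r \<subseteq> A \<or> A \<subseteq> - ball 0 r"
  shows "A \<in> origin_regular"
  using assms by (auto simp: origin_regular_def)

lemma origin_regular_Int:
  assumes "A \<in> origin_regular" "B \<in> origin_regular"
  shows "A \<inter> B \<in> origin_regular"
proof -
  obtain r s where "r > 0" "ball 0 r \<subseteq> A \<or> A \<subseteq> - ball 0 r" "s > 0" "ball 0 s \<subseteq> B \<or> B \<subseteq> - ball 0 s"
    using assms by (auto simp: origin_regular_def)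
  moreover have "ball 0 (min r s) \<subseteq> ball (0::'a) r" "ball 0 (min r s) \<subseteq> ball (0::'a) s"
    by auto
  ultimately have "ball 0 (min r s) \<subseteq> A \<inter> B \<or> A \<inter> B \<subseteq> - ball 0 (min r s)" "min r s > 0"
    by (blast, simp)
  then show ?thesis
    using assms by (intro origin_regularI[where r = "min r s"]) (auto simp: origin_regular_borel)
qed

lemma origin_regular_Compl: "A \<in> origin_regular \<Longrightarrow> - A \<in> origin_regular"
  unfolding origin_regular_def mem_Collect_eq by (metis borel_comp compl_le_swap1 Compl_subset_Compl_iff)

lemma origin_regular_Diff:
  "A \<in> origin_regular \<Longrightarrow> B \<in> origin_regular \<Longrightarrow> A - B \<in> origin_regular"
  by (simp add: origin_regular_Int origin_regular_Compl Diff_eq)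

lemma origin_regular_UNIV: "UNIV \<in> origin_regular"
  by (rule origin_regularI[where r = 1]) auto

lemma origin_regular_empty: "{} \<in> origin_regular"
  by (rule origin_regularI[where r = 1]) auto

text \<open>An open set that contains \<open>0\<close> is itself origin regular, and an open set that misses \<open>0\<close> is the
  union of the parts of it that lie outside the balls of radius \<open>1/n\<close>.\<close>

lemma sigma_sets_origin_regular:
  "sets (borel :: 'a::euclidean_space measure) = sigma_sets UNIV origin_regular"
proof
  show "sigma_sets UNIV origin_regular \<subseteq> sets (borel :: 'a measure)"
    using sigma_sets_le_sets_iff[of "borel :: 'a measure" origin_regular]
    by (auto simp: origin_regular_borel)
  have "U \<in> sigma_sets UNIV origin_regular" if op: "open U" for U :: "'a set"
  proof (cases "0 \<in> U")
    case True
    then obtain r where "r > 0" "ball 0 r \<subseteq> U"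
      by (metis op openE)
    then show ?thesis
      using that by (intro sigma_sets.Basic origin_regularI) auto
  next
    case False
    have "U - ball 0 (inverse (real (Suc n))) \<in> origin_regular" for n
      using that by (intro origin_regularI[where r = "inverse (real (Suc n))"]) auto
    moreover have "U = (\<Union>n. U - ball 0 (inverse (real (Suc n))))"
    proof -
      have "\<exists>n. inverse (real (Suc n)) \<le> norm x" if "x \<in> U" for x
      proof -
        have "norm x > 0" using that False by auto
        then show ?thesis using reals_Archimedean less_imp_le by blast
      qed
      then show ?thesis
        unfolding set_eq_iff UN_iff Diff_iff mem_ball_0 not_less by blast
    qed
    ultimately show ?thesis
      by (metis sigma_sets.Basic sigma_sets.Union)
  qed
  then have "{U :: 'a set. open U} \<subseteq> sigma_sets UNIV origin_regular" by auto
  then show "sets (borel :: 'a measure) \<subseteq> sigma_sets UNIV origin_regular"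
    unfolding borel_def by (simp add: sets_measure_of sigma_sets_mono)
qed

lemma sets_borel_prod_origin_regular:
  "sets (borel :: ('a::euclidean_space \<times> 'b::euclidean_space) measure) =
    sigma_sets UNIV {A \<times> B | A B. A \<in> origin_regular \<and> B \<in> origin_regular}"
proof -
  have "sets ((borel :: 'a measure) \<Otimes>\<^sub>M (borel :: 'b measure)) =
    sets (sigma (space borel \<times> space borel) {A \<times> B | A B. A \<in> origin_regular \<and> B \<in> origin_regular})"
    by (rule sets_pair_eq[where Ca = "{UNIV}" and Cb = "{UNIV}"])
       (auto simp: sigma_sets_origin_regular origin_regular_UNIV)
  then show ?thesis
    unfolding borel_prod by (simp add: sets_measure_of)
qed

section \<open>Regularity of Levy measures off the origin\<close>

lemma levy_measure_finite_off_origin: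
  assumes "levy_measure M" "r > 0"
  shows "emeasure M (- ball 0 r) < \<infinity>"
proof -
  have [measurable_cong]: "sets M = sets borel" using assms by (simp add: levy_measure_def)
  define c where "c = min 1 (r\<^sup>2)"
  have "c > 0" using \<open>r > 0\<close> by (simp add: c_def)
  have le: "c * indicator (- ball 0 r) x \<le> min 1 ((norm x)\<^sup>2)" for x :: 'a
  proof (cases "x \<in> ball 0 r")
    case False
    then have "r\<^sup>2 \<le> (norm x)\<^sup>2" using \<open>r > 0\<close> by (intro power_mono) auto
    then show ?thesis using False by (auto simp: c_def)
  qed auto
  have "ennreal c * indicator (- ball 0 r) x \<le> ennreal (min 1 ((norm x)\<^sup>2))" for x :: 'a
    using le[of x] \<open>c > 0\<close> by (cases "x \<in> ball 0 r") (auto intro!: ennreal_leI)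
  then have "(\<integral>\<^sup>+x. ennreal c * indicator (- ball 0 r) x \<partial>M) \<le> (\<integral>\<^sup>+x. ennreal (min 1 ((norm x)\<^sup>2)) \<partial>M)"
    by (intro nn_integral_mono)
  then have "ennreal c * emeasure M (- ball 0 r) < \<infinity>"
    using assms by (subst (asm) nn_integral_cmult_indicator) (auto simp: levy_measure_def)
  then show ?thesis
    using \<open>c > 0\<close> by (auto simp: ennreal_mult_less_top)
qed

text \<open>A Levy measure is finite off every ball around \<open>0\<close>, so outer regularity of finite Borel measures
  applies to its restriction there. The set \<open>A\<close> agrees with \<open>{}\<close> or with \<open>UNIV\<close> near \<open>0\<close>; hence the open
  superset can be chosen so that nothing is added near \<open>0\<close>, even if \<open>A\<close> has infinite measure.\<close>

lemma outer_approx_off_origin: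
  fixes M :: "'a::euclidean_space measure"
  assumes "levy_measure M" "A \<in> origin_regular" "e > 0"
  obtains U r where "open U" "A \<subseteq> U" "r > 0" "U - A \<subseteq> - ball 0 r" "emeasure M (U - A) \<le> ennreal e"
proof -
  have sM [measurable_cong]: "sets M = sets borel" using assms by (simp add: levy_measure_def)
  have A [measurable]: "A \<in> sets borel" using assms by (simp add: origin_regular_def)
  obtain r where r: "r > 0" "ball 0 r \<subseteq> A \<or> A \<subseteq> - ball 0 r"
    using assms by (auto simp: origin_regular_def)
  define R where "R = - ball (0::'a) (r/2)"
  have R [measurable]: "R \<in> sets borel" by (auto simp: R_def)
  define M' where "M' = density M (indicator R)"
  have sM' [measurable_cong]: "sets M' = sets borel" by (simp add: M'_def sM)
  have eM': "emeasure M' S = emeasure M (R \<inter> S)" if "S \<in> sets borel" for S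
    using that by (simp add: M'_def emeasure_density sM nn_integral_set_ennreal flip: indicator_inter_arith)
  have spM': "space M' = UNIV" using sM' by (metis sets_eq_imp_space_eq space_borel)
  have fin: "emeasure M' (space M') < \<infinity>"
    using levy_measure_finite_off_origin[OF assms(1), of "r/2"] r by (simp add: eM' spM' R_def)
  interpret finite_measure M' using fin by (intro finite_measureI) simp
  have "emeasure M' A < emeasure M' A + ennreal e"
    using \<open>e > 0\<close> by (simp add: emeasure_eq_measure ennreal_less_iff flip: ennreal_plus)
  then have "(INF U \<in> {U. A \<subseteq> U \<and> open U}. emeasure M' U) < emeasure M' A + ennreal e"
    using outer_regular[OF sM' _ A] by simp
  then obtain U0 where U0: "A \<subseteq> U0" "open U0" "emeasure M' U0 < emeasure M' A + ennreal e"
    by (auto simp: INF_less_iff)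
  \<comment> \<open>If \<open>A\<close> misses \<open>ball 0 r\<close>, the superset has to be kept away from \<open>0\<close> as well.\<close>
  define U where "U = (if ball 0 r \<subseteq> A then U0 else U0 - cball 0 (r/2))"
  have AU: "A \<subseteq> U" "open U" "U \<subseteq> U0"
    using U0 r by (auto simp: U_def subset_iff)
  have off: "U - A \<subseteq> R" 
    using r by (auto simp: U_def R_def subset_iff)
  have "emeasure M (U - A) = emeasure M' (U - A)"
    using off AU by (simp add: eM' Int_absorb1)
  also have "\<dots> \<le> emeasure M' (U0 - A)"
    using AU U0 by (intro emeasure_mono) auto
  also have "\<dots> = emeasure M' U0 - emeasure M' A"
    using U0 by (intro emeasure_Diff) auto
  also have "\<dots> \<le> ennreal e"
    using U0(3) by (metis ennreal_minus_le_iff less_imp_le add.commute emeasure_finite)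
  finally show ?thesis
    using that[of U "r/2"] AU off r by (auto simp: R_def)
qed

text \<open>The complement of an open superset of \<open>- A\<close> is a closed subset of \<open>A\<close>; cutting it at a large ball
  makes it compact and costs little, since the measure is finite far out. If \<open>A\<close> contains a ball around
  \<open>0\<close>, so does the compact set.\<close>

lemma inner_approx_off_origin:
  fixes M :: "'a::euclidean_space measure"
  assumes "levy_measure M" "A \<in> origin_regular" "e > 0"
  obtains K r where "compact K" "K \<subseteq> A" "r > 0" "A - K \<subseteq> - ball 0 r" "emeasure M (A - K) \<le> ennreal e"
proof -
  have sM [measurable_cong]: "sets M = sets borel" using assms by (simp add: levy_measure_def)
  have A [measurable]: "A \<in> sets borel" using assms by (simp add: origin_regular_def)
  obtain U r where U: "open U" "- A \<subseteq> U" "r > 0" "U - (- A) \<subseteq> - ball 0 r" "emeasure M (U - (- A)) \<le> ennreal (e/2)"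
    using outer_approx_off_origin[OF assms(1) origin_regular_Compl[OF assms(2)], of "e/2"] \<open>e > 0\<close> by auto
  have "(\<lambda>n. emeasure M (- ball 0 (real (Suc n)))) \<longlonglongrightarrow> emeasure M (\<Inter>n. - ball 0 (real (Suc n)))"
    using levy_measure_finite_off_origin[OF assms(1)]
    by (intro Lim_emeasure_decseq) (auto simp: decseq_def less_top[symmetric] sM)
  moreover have "(\<Inter>n. - ball (0::'a) (real (Suc n))) = {}"
  proof -
    have "\<exists>n. norm x < real (Suc n)" for x :: 'a
      by (metis reals_Archimedean2 less_trans of_nat_less_iff lessI)
    then show ?thesis unfolding set_eq_iff INT_iff Compl_iff mem_ball_0 by blast
  qed
  ultimately have "(\<lambda>n. emeasure M (- ball 0 (real (Suc n)))) \<longlonglongrightarrow> 0" by simp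
  then have "\<forall>\<^sub>F n in sequentially. emeasure M (- ball 0 (real (Suc n))) < ennreal (e/2)"
    using \<open>e > 0\<close> by (intro order_tendstoD) auto
  then obtain n where n: "emeasure M (- ball 0 (real (Suc n))) < ennreal (e/2)"
    by (auto simp: eventually_sequentially)
  define K where "K = - U \<inter> cball 0 (real (Suc n))"
  have K: "compact K" using U(1) by (auto simp: K_def intro!: closed_Int_compact)
  \<comment> \<open>The ball has radius at least \<open>1\<close>, so the second piece stays off \<open>ball 0 1\<close>.\<close>
  have "A - K \<subseteq> (U - (- A)) \<union> (- ball 0 (real (Suc n)))" by (auto simp: K_def)
  then have "emeasure M (A - K) \<le> emeasure M ((U - (- A)) \<union> (- ball 0 (real (Suc n))))"
    using U by (intro emeasure_mono) auto
  also have "\<dots> \<le> emeasure M (U - (- A)) + emeasure M (- ball 0 (real (Suc n)))"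
    using U by (intro emeasure_subadditive) auto
  also have "\<dots> \<le> ennreal (e/2) + ennreal (e/2)"
    using U n by (intro add_mono) auto
  also have "\<dots> = ennreal e" using \<open>e > 0\<close> by (simp flip: ennreal_plus)
  finally have "emeasure M (A - K) \<le> ennreal e" .
  moreover have "A - K \<subseteq> - ball 0 (min r 1)"
    using \<open>A - K \<subseteq> _\<close> U(4) by (auto simp: subset_iff)
  moreover have "K \<subseteq> A" using U by (auto simp: K_def)
  ultimately show ?thesis using that[of K "min r 1"] K \<open>r > 0\<close> by auto
qed

section \<open>From finitely additive couplings to measures\<close>

text \<open>A finitely additive set function on the Borel sets of the product space that has the
  marginals of a Levy coupling away from the origin. Limits of couplings along a filter are of this kind; they need not be countably additive.\<close>

definition coupling_content ::
    "'a::euclidean_space measure \<Rightarrow> 'a measure \<Rightarrow> (('a \<times> 'a) set \<Rightarrow> ennreal) \<Rightarrow> bool" where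
  "coupling_content M N m \<longleftrightarrow>
     positive (sets borel) m \<and> additive (sets borel) m \<and>
     (\<forall>r>0. \<forall>E\<in>sets borel. E \<subseteq> - ball 0 r \<longrightarrow>
        m (E \<times> UNIV) = emeasure M E \<and> m (UNIV \<times> E) = emeasure N E)"

text \<open>The compactness argument for measures with given marginals. Shrink the covered rectangle to a
  compact one and enlarge the covering rectangles to open ones; a finite subcover exists, to which finite
  additivity applies. A set that is lost or gained lies over a small set of \<open>M\<close> or of \<open>N\<close> away from
  \<open>0\<close>, where the marginals of \<open>m\<close> are known, so the error is controlled by \<open>M\<close> and \<open>N\<close> alone. This is
  where origin regularity matters: for other sides of the rectangle the error would reach
  the origin, where the marginals of \<open>m\<close> are unknown.\<close>

lemma coupling_content_rectangle_subadditive: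
  fixes A :: "nat \<Rightarrow> 'a::euclidean_space set"
  assumes levy: "levy_measure M" "levy_measure N" and m: "coupling_content M N m"
    and A0: "A0 \<in> origin_regular" and B0: "B0 \<in> origin_regular"
    and A: "\<And>n. A n \<in> origin_regular" and B: "\<And>n. B n \<in> origin_regular"
    and cover: "A0 \<times> B0 \<subseteq> (\<Union>n. A n \<times> B n)"
  shows "m (A0 \<times> B0) \<le> (\<Sum>n. m (A n \<times> B n))"
proof (rule ennreal_le_epsilon)
  fix e :: real assume e: "e > 0"
  have pos: "positive (sets borel) m" and add: "additive (sets borel) m"
    using m by (simp_all add: coupling_content_def)
  have mono: "m S \<le> m T" if "S \<subseteq> T" "S \<in> sets borel" "T \<in> sets borel" for S T
    using sets.additive_increasing[OF pos add] that by (auto simp: increasing_def)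
  have un: "m (S \<union> T) \<le> m S + m T" if "S \<in> sets borel" "T \<in> sets borel" for S T
  proof -
    have "m (S \<union> T) = m S + m (T - S)"
      using add that unfolding additive_def by (metis Diff_disjoint Un_Diff_cancel sets.Diff)
    then show ?thesis using mono[of "T - S" T] that by (simp add: add_left_mono)
  qed
  have mM: "m (E \<times> UNIV) = emeasure M E" and mN: "m (UNIV \<times> E) = emeasure N E"
    if "E \<in> sets borel" "r > 0" "E \<subseteq> - ball 0 r" for E r
    using m that unfolding coupling_content_def by blast+
  note reg = origin_regular_borel
  have times: "S \<times> T \<in> sets borel" if "S \<in> sets borel" "T \<in> sets borel" for S T :: "'a set"
    using that by (simp add: borel_Times)
  obtain K r where K: "compact K" "K \<subseteq> A0" "r > 0" "A0 - K \<subseteq> - ball 0 r" "emeasure M (A0 - K) \<le> ennreal (e/4)"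
    using inner_approx_off_origin[OF levy(1) A0, of "e/4"] e by auto
  obtain L s where L: "compact L" "L \<subseteq> B0" "s > 0" "B0 - L \<subseteq> - ball 0 s" "emeasure N (B0 - L) \<le> ennreal (e/4)"
    using inner_approx_off_origin[OF levy(2) B0, of "e/4"] e by auto
  \<comment> \<open>Each cell is enlarged in both coordinates; the total error is \<open>2 * (\<Sum>n. d n) = e/2\<close>.\<close>
  define d where "d n = e/4 * (1/2) ^ Suc n" for n
  have d: "d n > 0" for n using e by (simp add: d_def)
  have "\<exists>U r. open U \<and> A n \<subseteq> U \<and> r > 0 \<and> U - A n \<subseteq> - ball 0 r \<and> emeasure M (U - A n) \<le> ennreal (d n)" for n
    using outer_approx_off_origin[OF levy(1) A d, of n] by metis
  then obtain U u where U: "\<And>n. open (U n)" "\<And>n. A n \<subseteq> U n" "\<And>n. u n > 0"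
      "\<And>n. U n - A n \<subseteq> - ball 0 (u n)" "\<And>n. emeasure M (U n - A n) \<le> ennreal (d n)"
    by metis
  have "\<exists>U r. open U \<and> B n \<subseteq> U \<and> r > 0 \<and> U - B n \<subseteq> - ball 0 r \<and> emeasure N (U - B n) \<le> ennreal (d n)" for n
    using outer_approx_off_origin[OF levy(2) B d, of n] by metis
  then obtain V v where V: "\<And>n. open (V n)" "\<And>n. B n \<subseteq> V n" "\<And>n. v n > 0"
      "\<And>n. V n - B n \<subseteq> - ball 0 (v n)" "\<And>n. emeasure N (V n - B n) \<le> ennreal (d n)"
    by metis
  have Kb [simp]: "K \<in> sets borel" "L \<in> sets borel" and UVb [simp]: "U n \<in> sets borel" "V n \<in> sets borel" for n
    using K(1) L(1) U(1) V(1) by (auto intro: borel_compact)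
  have cells: "m (U n \<times> V n) \<le> m (A n \<times> B n) + ennreal (2 * d n)" for n
  proof -
    have "m (U n \<times> V n) \<le> m (A n \<times> B n \<union> ((U n - A n) \<times> UNIV \<union> UNIV \<times> (V n - B n)))"
      using U(2) V(2) A B by (intro mono sets.Un times) (auto simp: reg)
    also have "\<dots> \<le> m (A n \<times> B n) + (m ((U n - A n) \<times> UNIV) + m (UNIV \<times> (V n - B n)))"
      using A B by (intro order_trans[OF un] add_left_mono un sets.Un times) (auto simp: reg)
    also have "\<dots> = m (A n \<times> B n) + (emeasure M (U n - A n) + emeasure N (V n - B n))"
      using mM[OF sets.Diff[OF UVb(1) reg[OF A]] U(3,4)] mN[OF sets.Diff[OF UVb(2) reg[OF B]] V(3,4)]
      by simp
    also have "\<dots> \<le> m (A n \<times> B n) + (ennreal (d n) + ennreal (d n))"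
      using U V by (intro add_left_mono add_mono) auto
    also have "\<dots> = m (A n \<times> B n) + ennreal (2 * d n)"
      using d[of n] by (simp flip: ennreal_plus)
    finally show ?thesis .
  qed
  have "K \<times> L \<subseteq> (\<Union>n\<in>UNIV. U n \<times> V n)"
  proof -
    have "K \<times> L \<subseteq> (\<Union>n. A n \<times> B n)" using K(2) L(2) cover by blast
    also have "\<dots> \<subseteq> (\<Union>n. U n \<times> V n)" using U(2) V(2) by (intro UN_mono Sigma_mono) auto
    finally show ?thesis by simp
  qed
  then obtain J where J: "finite J" "K \<times> L \<subseteq> (\<Union>n\<in>J. U n \<times> V n)"
    by (rule compactE_image[OF compact_Times[OF K(1) L(1)] open_Times[OF U(1) V(1)]])
  have "m (A0 \<times> B0) \<le> m ((\<Union>n\<in>J. U n \<times> V n) \<union> ((A0 - K) \<times> UNIV \<union> UNIV \<times> (B0 - L)))"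
  proof (rule mono)
    show "A0 \<times> B0 \<subseteq> (\<Union>n\<in>J. U n \<times> V n) \<union> ((A0 - K) \<times> UNIV \<union> UNIV \<times> (B0 - L))"
      using J(2) by blast
    show "(\<Union>n\<in>J. U n \<times> V n) \<union> ((A0 - K) \<times> UNIV \<union> UNIV \<times> (B0 - L)) \<in> sets borel"
      using J(1) A0 B0 by (intro sets.Un sets.finite_UN times) (auto simp: reg)
  qed (simp add: A0 B0 reg times)
  also have "\<dots> \<le> m (\<Union>n\<in>J. U n \<times> V n) + (m ((A0 - K) \<times> UNIV) + m (UNIV \<times> (B0 - L)))"
    using A0 B0 J(1)
    by (intro order_trans[OF un] add_left_mono un sets.Un sets.finite_UN times) (auto simp: reg)
  also have "\<dots> = m (\<Union>n\<in>J. U n \<times> V n) + (emeasure M (A0 - K) + emeasure N (B0 - L))"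
    using mM[OF sets.Diff[OF reg[OF A0] Kb(1)] K(3,4)] mN[OF sets.Diff[OF reg[OF B0] Kb(2)] L(3,4)]
    by simp
  also have "\<dots> \<le> (\<Sum>n\<in>J. m (U n \<times> V n)) + (ennreal (e/4) + ennreal (e/4))"
    using K L J(1)
    by (intro add_mono sets.subadditive[OF pos add]) (auto intro!: times)
  also have "\<dots> \<le> (\<Sum>n\<in>J. m (A n \<times> B n) + ennreal (2 * d n)) + ennreal (e/2)"
    using cells e by (intro add_mono sum_mono) (auto simp flip: ennreal_plus)
  also have "\<dots> = (\<Sum>n\<in>J. m (A n \<times> B n)) + ennreal (\<Sum>n\<in>J. 2 * d n) + ennreal (e/2)"
    using d by (simp add: sum.distrib less_imp_le)
  also have "\<dots> \<le> (\<Sum>n. m (A n \<times> B n)) + ennreal (e/2) + ennreal (e/2)"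
  proof (intro add_mono order_refl ennreal_leI)
    show "(\<Sum>n\<in>J. m (A n \<times> B n)) \<le> (\<Sum>n. m (A n \<times> B n))"
      using J(1) by (intro sum_le_suminf) auto
    have "(\<lambda>n. e/2 * (1/2) ^ Suc n) sums (e/2 * 1)"
      by (intro sums_mult power_half_series)
    then have "(\<lambda>n. 2 * d n) sums (e/2)" by (simp add: d_def)
    then show "(\<Sum>n\<in>J. 2 * d n) \<le> e/2"
      using J(1) d sum_le_suminf[of "\<lambda>n. 2 * d n" J] by (simp add: sums_iff less_imp_le)
  qed
  also have "\<dots> = (\<Sum>n. m (A n \<times> B n)) + ennreal e"
    using e by (simp add: add.assoc flip: ennreal_plus)
  finally show "m (A0 \<times> B0) \<le> (\<Sum>n. m (A n \<times> B n)) + ennreal e" .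
qed

lemma semiring_origin_regular_rectangles:
  "semiring_of_sets UNIV {A \<times> B | (A :: 'a::euclidean_space set) (B :: 'a set). A \<in> origin_regular \<and> B \<in> origin_regular}"
    (is "semiring_of_sets UNIV ?R")
proof
  show "?R \<subseteq> Pow UNIV" by simp
  show "{} \<in> ?R" using origin_regular_empty by blast
  fix S T assume "S \<in> ?R" "T \<in> ?R"
  then obtain A B C D where ST: "S = A \<times> B" "T = C \<times> D"
    and reg: "A \<in> origin_regular" "B \<in> origin_regular" "C \<in> origin_regular" "D \<in> origin_regular"
    by blast
  have rectI: "P \<times> Q \<in> ?R" if "P \<in> origin_regular" "Q \<in> origin_regular" for P Q
    using that by blast
  show "S \<inter> T \<in> ?R"
    unfolding ST Times_Int_Times by (intro rectI origin_regular_Int reg)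
  show "\<exists>C\<subseteq>?R. finite C \<and> disjoint C \<and> S - T = \<Union> C"
  proof (intro exI conjI)
    show "{(A - C) \<times> B, (A \<inter> C) \<times> (B - D)} \<subseteq> ?R"
      by (intro insert_subsetI empty_subsetI rectI origin_regular_Diff origin_regular_Int reg)
    show "disjoint {(A - C) \<times> B, (A \<inter> C) \<times> (B - D)}"
      by (auto simp: disjoint_def)
    show "S - T = \<Union> {(A - C) \<times> B, (A \<inter> C) \<times> (B - D)}"
      by (auto simp: ST)
  qed simp
qed

text \<open>Finite additivity bounds every series over a partition of a rectangle from above and the covering estimate
  bounds it from below, so Caratheodory's theorem applies to the semiring of origin regular rectangles.
  Elsewhere the resulting measure and \<open>m\<close> may differ: mass that drifts to an axis in the limit ends up
  on that axis.\<close>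

lemma coupling_content_extension:
  assumes levy: "levy_measure M" "levy_measure N" and m: "coupling_content M N m"
  obtains G where "sets G = sets borel"
    "\<And>A B. A \<in> origin_regular \<Longrightarrow> B \<in> origin_regular \<Longrightarrow> emeasure G (A \<times> B) = m (A \<times> B)"
proof -
  define R where "R = {A \<times> B | (A :: 'a set) (B :: 'a set). A \<in> origin_regular \<and> B \<in> origin_regular}"
  define G where "G = extend_measure UNIV R (\<lambda>S. S) m"
  have pos: "positive (sets borel) m" and add: "additive (sets borel) m"
    using m by (simp_all add: coupling_content_def)
  have mono: "m S \<le> m T" if "S \<subseteq> T" "S \<in> sets borel" "T \<in> sets borel" for S T
    using sets.additive_increasing[OF pos add] that by (auto simp: increasing_def)
  have R: "R \<subseteq> sets borel"
    by (auto simp: R_def borel_Times origin_regular_borel)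
  have "sets G = sigma_sets UNIV R" by (simp add: G_def sets_extend_measure)
  then have "sets G = sets borel" by (simp add: R_def sets_borel_prod_origin_regular)
  moreover have "emeasure G S = m S" if "S \<in> R" for S
  proof (rule extend_measure_caratheodory[OF G_def that])
    show "semiring_of_sets UNIV ((\<lambda>S. S) ` R)"
      using semiring_origin_regular_rectangles by (simp add: R_def)
    show "m i = 0" if "i = {}" for i using pos that by (simp add: positive_def)
    fix P :: "nat \<Rightarrow> ('a \<times> 'a) set" and j
    assume P: "P \<in> UNIV \<rightarrow> R" and j: "j \<in> R" and "disjoint_family ((\<lambda>S. S) \<circ> P)" and un: "(\<Union>i. P i) = j"
    then have disj: "disjoint_family P" by (simp add: comp_def)
    have Pb: "P n \<in> sets borel" for n using P R by auto
    show "(\<Sum>n. m (P n)) = m j"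
    proof (rule antisym)
      show "(\<Sum>n. m (P n)) \<le> m j"
      proof (rule suminf_le_const)
        fix n
        have "(\<Sum>i<n. m (P i)) = m (\<Union>i<n. P i)"
          using Pb disj by (intro sets.additive_sum[OF pos add]) (auto intro: disjoint_family_on_mono)
        also have "\<dots> \<le> m j"
          using un j R Pb by (intro mono) auto
        finally show "(\<Sum>i<n. m (P i)) \<le> m j" .
      qed simp
      have "\<exists>A B. A \<in> origin_regular \<and> B \<in> origin_regular \<and> P n = A \<times> B" for n
        using P unfolding R_def Pi_iff by blast
      then obtain A B where AB: "\<And>n. A n \<in> origin_regular" "\<And>n. B n \<in> origin_regular" "\<And>n. P n = A n \<times> B n"
        by metis
      obtain A0 B0 where "A0 \<in> origin_regular" "B0 \<in> origin_regular" "j = A0 \<times> B0"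
        using j by (auto simp: R_def)
      then show "m j \<le> (\<Sum>n. m (P n))"
        using coupling_content_rectangle_subadditive[OF levy m, of A0 B0 A B] AB un by simp
    qed
  qed auto
  ultimately show ?thesis using that[of G] by (auto simp: R_def)
qed

text \<open>The image measure under \<open>f\<close> and \<open>M\<close> agree away from \<open>0\<close>, hence by continuity from below on all
  of \<open>- {0}\<close>. At \<open>0\<close> they may differ, which \<open>h 0 = 0\<close> makes harmless.\<close>

lemma nn_integral_off_origin_marginal:
  fixes f :: "'b::topological_space \<Rightarrow> 'a::euclidean_space"
  assumes sG [measurable_cong]: "sets G = sets borel" and M: "levy_measure M"
    and f [measurable]: "f \<in> borel \<rightarrow>\<^sub>M borel" and h [measurable]: "h \<in> borel_measurable borel" and "h 0 = 0"
    and marg: "\<And>E r. E \<in> sets borel \<Longrightarrow> r > 0 \<Longrightarrow> E \<subseteq> - ball 0 r \<Longrightarrow> emeasure G (f -` E) = emeasure M E"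
  shows "(\<integral>\<^sup>+z. h (f z) \<partial>G) = (\<integral>\<^sup>+x. h x \<partial>M)"
proof -
  have sM: "sets M = sets borel" and M0: "emeasure M {0} = 0" using M by (simp_all add: levy_measure_def)
  have spG: "space G = UNIV" using sets_eq_imp_space_eq[OF sG] by simp
  define D where "D = density (distr G borel f) (indicator (- {0}))"
  have "D = M"
  proof (rule measure_eqI)
    show "sets D = sets M" by (simp add: D_def sM)
    fix E assume "E \<in> sets D"
    then have E [measurable]: "E \<in> sets borel" by (simp add: D_def)
    define En where "En n = E - ball 0 (inverse (real (Suc n)))" for n
    have En [measurable]: "En n \<in> sets borel" for n by (simp add: En_def)
    have inc: "incseq En"
    proof (rule incseq_SucI)
      fix n
      have "inverse (real (Suc (Suc n))) \<le> inverse (real (Suc n))" by (intro le_imp_inverse_le) auto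
      then have "ball 0 (inverse (real (Suc (Suc n)))) \<subseteq> ball (0::'a) (inverse (real (Suc n)))"
        by (rule subset_ball)
      then show "En n \<le> En (Suc n)" unfolding En_def by blast
    qed
    have UnE: "(\<Union>n. En n) = E - {0}"
    proof -
      have "\<exists>n. inverse (real (Suc n)) \<le> norm x" if "x \<noteq> 0" for x :: 'a
        using reals_Archimedean[of "norm x"] that less_imp_le by auto
      then show ?thesis
        unfolding En_def set_eq_iff UN_iff Diff_iff mem_ball_0 not_less singleton_iff
        by (auto simp del: of_nat_Suc)
    qed
    have "indicator (- {0}) x * indicator E x = (indicator (E - {0}) x :: ennreal)" for x
      by (simp split: split_indicator)
    then have "emeasure D E = emeasure (distr G borel f) (E - {0})"
      by (simp add: D_def emeasure_density)
    also have "\<dots> = emeasure G (f -` (E - {0}))"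
      by (simp add: emeasure_distr spG)
    also have "f -` (E - {0}) = (\<Union>n. f -` En n)" by (simp add: UnE flip: vimage_UN)
    also have "emeasure G (\<Union>n. f -` En n) = (SUP n. emeasure G (f -` En n))"
    proof (rule SUP_emeasure_incseq[symmetric])
      show "range (\<lambda>n. f -` En n) \<subseteq> sets G"
        using measurable_sets_borel[OF f En] by (auto simp: sG)
      show "incseq (\<lambda>n. f -` En n)" using inc by (auto simp: incseq_def)
    qed
    also have "\<dots> = (SUP n. emeasure M (En n))"
      by (intro SUP_cong refl marg[OF En]) (auto simp: En_def)
    also have "\<dots> = emeasure M (\<Union>n. En n)"
      by (intro SUP_emeasure_incseq) (use inc in \<open>auto simp: sM\<close>)
    also have "\<dots> = emeasure M E"
      unfolding UnE by (intro emeasure_Diff_null_set) (auto simp: sM M0 null_sets_def)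
    finally show "emeasure D E = emeasure M E" .
  qed
  then have "(\<integral>\<^sup>+x. h x \<partial>M) = (\<integral>\<^sup>+x. indicator (- {0}) x * h x \<partial>distr G borel f)"
    unfolding D_def by (auto simp: nn_integral_density simp flip: \<open>D = M\<close>)
  also have "\<dots> = (\<integral>\<^sup>+x. h x \<partial>distr G borel f)"
    using \<open>h 0 = 0\<close> by (intro nn_integral_cong) (auto split: split_indicator)
  also have "\<dots> = (\<integral>\<^sup>+z. h (f z) \<partial>G)"
    by (intro nn_integral_distr) auto
  finally show ?thesis by simp
qed

section \<open>Limits along filters\<close>

text \<open>Tychonoff's theorem for the compact space \<open>ennreal\<close>. The index set \<open>'b\<close> will be the type of all
  subsets of the product space, far too large for a diagonal sequence; a filter below
  \<open>sequentially\<close> takes the place of a subsequence.\<close>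

lemma pointwise_limit_along_subfilter:
  fixes g :: "nat \<Rightarrow> 'b \<Rightarrow> ennreal"
  obtains F m where "F \<noteq> bot" "F \<le> sequentially" "\<And>b. ((\<lambda>n. g n b) \<longlongrightarrow> m b) F"
proof -
  have "compact_space (product_topology (\<lambda>b::'b. euclidean :: ennreal topology) UNIV)"
    unfolding compact_space_product_topology
    by (auto simp: compact_space_def compactin_euclidean_iff compact_UNIV)
  then have "compact (UNIV :: ('b \<Rightarrow> ennreal) set)"
    by (simp add: euclidean_product_topology compact_space_def compactin_euclidean_iff)
  then obtain m where m: "inf (nhds m) (filtermap g sequentially) \<noteq> bot"
    unfolding compact_filter by (auto simp: filtermap_bot_iff dest!: spec[of _ "filtermap g sequentially"])
  define F where "F = inf (filtercomap g (nhds m)) sequentially"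
  have "F \<noteq> bot"
  proof
    assume "F = bot"
    then obtain P Q where PQ: "eventually P (nhds m)" "eventually Q sequentially" "\<And>n. P (g n) \<Longrightarrow> Q n \<Longrightarrow> False"
      unfolding F_def trivial_limit_def eventually_inf eventually_filtercomap by blast
    then have "eventually (\<lambda>x. \<not> P x) (filtermap g sequentially)"
      by (auto simp: eventually_filtermap elim!: eventually_mono)
    then show False using m PQ(1) unfolding trivial_limit_def eventually_inf by blast
  qed
  moreover have "F \<le> sequentially" by (simp add: F_def)
  moreover have "((\<lambda>n. g n b) \<longlongrightarrow> m b) F" for b
  proof -
    have "filterlim g (nhds m) F" by (simp add: F_def filterlim_def filtermap_le_iff_le_filtercomap)
    then show ?thesis
      by (rule continuous_on_tendsto_compose[OF continuous_on_product_coordinates]) auto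
  qed
  ultimately show ?thesis using that by blast
qed

section \<open>Levy couplings\<close>

lemma levy_couplings_marginals:
  assumes "G \<in> levy_couplings M N" "E \<in> sets borel" "r > 0" "E \<subseteq> - ball 0 r"
  shows "emeasure G (E \<times> UNIV) = emeasure M E" "emeasure G (UNIV \<times> E) = emeasure N E"
proof -
  have "\<exists>U. open U \<and> 0 \<in> U \<and> E \<inter> U = {}"
    using assms by (intro exI[of _ "ball 0 r"]) auto
  then show "emeasure G (E \<times> UNIV) = emeasure M E" "emeasure G (UNIV \<times> E) = emeasure N E"
    using assms(1,2) unfolding levy_couplings_def by blast+
qed

lemma levy_couplings_sets: "G \<in> levy_couplings M N \<Longrightarrow> sets G = sets borel"
  by (simp add: levy_couplings_def levy_measure_def)

lemma nn_integral_levy_marginals: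
  fixes G :: "('a::euclidean_space \<times> 'a) measure"
  assumes levy: "levy_measure M" "levy_measure N" and sG: "sets G = sets borel"
    and h: "h \<in> borel_measurable borel" "h 0 = 0"
    and marg: "\<And>E r. E \<in> sets borel \<Longrightarrow> r > 0 \<Longrightarrow> E \<subseteq> - ball 0 r \<Longrightarrow>
      emeasure G (E \<times> UNIV) = emeasure M E \<and> emeasure G (UNIV \<times> E) = emeasure N E"
  shows "(\<integral>\<^sup>+z. h (fst z) + h (snd z) \<partial>G) = (\<integral>\<^sup>+x. h x \<partial>M) + (\<integral>\<^sup>+y. h y \<partial>N)"
proof -
  have f: "fst \<in> (borel :: ('a \<times> 'a) measure) \<rightarrow>\<^sub>M borel" and s: "snd \<in> (borel :: ('a \<times> 'a) measure) \<rightarrow>\<^sub>M borel"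
    by (auto intro!: borel_measurable_continuous_onI continuous_intros)
  have "fst -` E = E \<times> (UNIV :: 'a set)" "snd -` E = (UNIV :: 'a set) \<times> E" for E :: "'a set" by auto
  then have "(\<integral>\<^sup>+z. h (fst z) \<partial>G) = (\<integral>\<^sup>+x. h x \<partial>M)" "(\<integral>\<^sup>+z. h (snd z) \<partial>G) = (\<integral>\<^sup>+y. h y \<partial>N)"
    using marg
    by (auto intro!: nn_integral_off_origin_marginal[OF sG levy(1) f h] nn_integral_off_origin_marginal[OF sG levy(2) s h])
  moreover have "(\<lambda>z. h (fst z)) \<in> borel_measurable G" "(\<lambda>z. h (snd z)) \<in> borel_measurable G"
    using measurable_compose[OF f h(1)] measurable_compose[OF s h(1)] by (simp_all cong: measurable_cong_sets add: sG)
  ultimately show ?thesis by (simp add: nn_integral_add)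
qed

lemma norm_prod_squared: "(norm z)\<^sup>2 = (norm (fst z))\<^sup>2 + (norm (snd z))\<^sup>2"
  by (simp add: norm_prod_def)

text \<open>Extend \<open>m\<close> from the origin regular rectangles to a measure and remove the atom that it may have
  at the origin. Integrability follows from \<open>min 1 (a + b) \<le> min 1 a + min 1 b\<close> and the marginals.\<close>

lemma levy_coupling_of_content:
  assumes levy: "levy_measure M" "levy_measure N" and m: "coupling_content M N m"
  obtains G where "G \<in> levy_couplings M N"
    "\<And>A B. A \<in> origin_regular \<Longrightarrow> B \<in> origin_regular \<Longrightarrow> \<not> (0 \<in> A \<and> 0 \<in> B) \<Longrightarrow>
       emeasure G (A \<times> B) = m (A \<times> B)"
proof -
  obtain G0 where sG0 [measurable_cong]: "sets G0 = sets borel"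
    and G0: "\<And>A B. A \<in> origin_regular \<Longrightarrow> B \<in> origin_regular \<Longrightarrow> emeasure G0 (A \<times> B) = m (A \<times> B)"
    using coupling_content_extension[OF levy m] by blast
  define G where "G = density G0 (indicator (- {0}))"
  have sG: "sets G = sets borel" by (simp add: G_def sG0)
  have eG: "emeasure G S = emeasure G0 (S - {0})" if [measurable]: "S \<in> sets borel" for S
  proof -
    have "indicator (- {0}) z * indicator S z = (indicator (S - {0}) z :: ennreal)" for z
      by (simp split: split_indicator)
    then show ?thesis by (simp add: G_def emeasure_density sG0)
  qed
  have rect: "emeasure G (A \<times> B) = m (A \<times> B)"
    if "A \<in> origin_regular" "B \<in> origin_regular" "\<not> (0 \<in> A \<and> 0 \<in> B)" for A B
  proof -
    have "A \<times> B - {0} = A \<times> B" using that by (auto simp: zero_prod_def)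
    then show ?thesis using that by (simp add: eG G0 borel_Times origin_regular_borel)
  qed
  have marg: "emeasure G (E \<times> UNIV) = emeasure M E \<and> emeasure G (UNIV \<times> E) = emeasure N E"
    if "E \<in> sets borel" "r > 0" "E \<subseteq> - ball 0 r" for E r
  proof -
    have "E \<in> origin_regular" "0 \<notin> E" using that by (auto intro: origin_regularI)
    then show ?thesis
      using rect[of E UNIV] rect[of UNIV E] m that origin_regular_UNIV
      unfolding coupling_content_def by fastforce
  qed
  have "levy_measure G"
    unfolding levy_measure_def
  proof (intro conjI)
    show "emeasure G {0} = 0" by (simp add: eG)
    have "(\<integral>\<^sup>+ z. ennreal (min 1 ((norm z)\<^sup>2)) \<partial>G)
        \<le> (\<integral>\<^sup>+ z. ennreal (min 1 ((norm (fst z))\<^sup>2)) + ennreal (min 1 ((norm (snd z))\<^sup>2)) \<partial>G)"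
    proof (intro nn_integral_mono)
      have sub: "min 1 (a + b) \<le> min 1 a + min 1 b" if "a \<ge> 0" "b \<ge> 0" for a b :: real
        using that by (simp add: min_def)
      show "ennreal (min 1 ((norm z)\<^sup>2)) \<le> ennreal (min 1 ((norm (fst z))\<^sup>2)) + ennreal (min 1 ((norm (snd z))\<^sup>2))" for z :: "'a \<times> 'a"
        using ennreal_leI[OF sub[of "(norm (fst z))\<^sup>2" "(norm (snd z))\<^sup>2"]]
        by (simp add: norm_prod_squared[of z] ennreal_plus)
    qed
    also have "\<dots> = (\<integral>\<^sup>+ x. ennreal (min 1 ((norm x)\<^sup>2)) \<partial>M) + (\<integral>\<^sup>+ x. ennreal (min 1 ((norm x)\<^sup>2)) \<partial>N)"
      by (intro nn_integral_levy_marginals[OF levy sG] marg) auto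
    also have "\<dots> < \<infinity>" using levy by (simp add: levy_measure_def)
    finally show "(\<integral>\<^sup>+ z. ennreal (min 1 ((norm z)\<^sup>2)) \<partial>G) < \<infinity>" .
  qed (simp add: sG)
  moreover have "emeasure G (E \<times> UNIV) = emeasure M E \<and> emeasure G (UNIV \<times> E) = emeasure N E"
    if EU: "E \<in> sets borel" "open U" "0 \<in> U" "E \<inter> U = {}" for E U
  proof -
    obtain r where "r > 0" "ball 0 r \<subseteq> U" by (metis openE EU(2,3))
    then show ?thesis using EU by (intro marg[of E r]) auto
  qed
  ultimately have "G \<in> levy_couplings M N"
    unfolding levy_couplings_def by blast
  then show ?thesis using that rect by blast
qed

text \<open>Put \<open>M\<close> on the first axis and \<open>N\<close> on the second: all mass is exchanged with the origin.\<close>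

lemma levy_couplings_nonempty:
  assumes levy: "levy_measure M" "levy_measure N"
  shows "levy_couplings M N \<noteq> {}"
proof -
  have sM: "sets M = sets borel" "sets N = sets borel" using levy by (simp_all add: levy_measure_def)
  define m where "m S = emeasure M ((\<lambda>x. (x, 0)) -` S) + emeasure N ((\<lambda>y. (0, y)) -` S)" for S
  have meas: "(\<lambda>x. (x, 0)) -` S \<in> sets M" "(\<lambda>y. (0, y)) -` S \<in> sets N" if "S \<in> sets borel" for S :: "('a \<times> 'a) set"
  proof -
    have "(\<lambda>x :: 'a. (x, 0 :: 'a)) \<in> borel \<rightarrow>\<^sub>M borel" "(\<lambda>y :: 'a. (0 :: 'a, y)) \<in> borel \<rightarrow>\<^sub>M borel"
      by (intro borel_measurable_continuous_onI continuous_intros)+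
    from this[THEN measurable_sets_borel, OF that]
    show "(\<lambda>x. (x, 0)) -` S \<in> sets M" "(\<lambda>y. (0, y)) -` S \<in> sets N"
      by (simp_all add: sM)
  qed
  have "coupling_content M N m"
    unfolding coupling_content_def
  proof (intro conjI allI impI ballI)
    show "positive (sets borel) m" by (simp add: positive_def m_def)
    show "additive (sets borel) m"
      unfolding additive_def
    proof (intro ballI impI)
      fix S T :: "('a \<times> 'a) set" assume ST: "S \<in> sets borel" "T \<in> sets borel" "S \<inter> T = {}"
      have "emeasure M ((\<lambda>x. (x, 0)) -` (S \<union> T)) = emeasure M ((\<lambda>x. (x, 0)) -` S) + emeasure M ((\<lambda>x. (x, 0)) -` T)"
        unfolding vimage_Un using ST meas by (intro plus_emeasure[symmetric]) auto
      moreover have "emeasure N ((\<lambda>x. (0, x)) -` (S \<union> T)) = emeasure N ((\<lambda>x. (0, x)) -` S) + emeasure N ((\<lambda>x. (0, x)) -` T)"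
        unfolding vimage_Un using ST meas by (intro plus_emeasure[symmetric]) auto
      ultimately show "m (S \<union> T) = m S + m T" by (simp add: m_def add_ac)
    qed
    fix r :: real and E :: "'a set" assume "r > 0" "E \<subseteq> - ball 0 r"
    then have "0 \<notin> E" by auto
    then have "(\<lambda>x. (x, 0)) -` (E \<times> UNIV) = E" "(\<lambda>y. (0, y)) -` (E \<times> UNIV) = {}"
      "(\<lambda>x. (x, 0)) -` (UNIV \<times> E) = {}" "(\<lambda>y. (0, y)) -` (UNIV \<times> E) = E" by auto
    then show "m (E \<times> UNIV) = emeasure M E" "m (UNIV \<times> E) = emeasure N E"
      using \<open>0 \<notin> E\<close> by (simp_all add: m_def)
  qed
  then show ?thesis using levy_coupling_of_content[OF levy] by blast
qed

lemma coupling_content_limit: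
  fixes G :: "'i \<Rightarrow> ('a::euclidean_space \<times> 'a) measure"
  assumes G: "\<And>i. G i \<in> levy_couplings M N" and F: "F \<noteq> bot"
    and lim: "\<And>S. ((\<lambda>i. emeasure (G i) S) \<longlongrightarrow> m S) F"
  shows "coupling_content M N m"
  unfolding coupling_content_def
proof (intro conjI allI impI ballI)
  have const: "m S = a" if "\<And>i. emeasure (G i) S = a" for S a
    using tendsto_unique[OF F lim[of S], of a] that by simp
  show "positive (sets borel) m" by (simp add: positive_def const)
  show "additive (sets borel) m"
    unfolding additive_def
  proof (intro ballI impI)
    fix S T :: "('a \<times> 'a) set" assume "S \<in> sets borel" "T \<in> sets borel" "S \<inter> T = {}"
    then have "emeasure (G i) (S \<union> T) = emeasure (G i) S + emeasure (G i) T" for i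
      using levy_couplings_sets[OF G] by (intro plus_emeasure[symmetric]) auto
    then have "((\<lambda>i. emeasure (G i) (S \<union> T)) \<longlongrightarrow> m S + m T) F"
      using tendsto_add[OF lim[of S] lim[of T]] by simp
    then show "m (S \<union> T) = m S + m T" using tendsto_unique[OF F lim] by blast
  qed
  fix r :: real and E :: "'a set" assume "r > 0" "E \<in> sets borel" "E \<subseteq> - ball 0 r"
  then show "m (E \<times> UNIV) = emeasure M E" "m (UNIV \<times> E) = emeasure N E"
    using levy_couplings_marginals[OF G] by (blast intro: const)+
qed

section \<open>Lower semicontinuity of the cost\<close>

lemma finite_net_selector:
  fixes D :: "'a::euclidean_space set"
  assumes "finite D"
  shows "\<exists>g. g \<in> borel_measurable borel \<and> finite (range g) \<and> (\<forall>x\<in>\<Union>d\<in>D. ball d e. dist (g x) x < e)"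
  using assms
proof induction
  case empty
  then show ?case by (intro exI[of _ "\<lambda>_. 0"]) auto
next
  case (insert d D)
  then obtain g where g [measurable]: "g \<in> borel_measurable borel"
    and fin: "finite (range g)" and near: "\<forall>x\<in>\<Union>d\<in>D. ball d e. dist (g x) x < e"
    by blast
  define h where "h x = (if dist d x < e then d else g x)" for x
  have "h \<in> borel_measurable borel" unfolding h_def by measurable
  moreover have "finite (range h)"
    by (rule finite_subset[of _ "insert d (range g)"]) (auto simp: h_def fin)
  moreover have "\<forall>x\<in>\<Union>d\<in>insert d D. ball d e. dist (h x) x < e"
    using near by (auto simp: h_def)
  ultimately show ?case by blast
qed

text \<open>Project to the ball of radius \<open>k\<close>, which does not increase distances, and then round to a finite
  net, with \<open>0\<close> taking precedence. Rounding after projecting gives the distance bound on the whole space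
  although the range is finite; it makes the rounded cost a lower bound for the true one.\<close>

lemma finite_range_approximation:
  fixes k :: real
  assumes "k > 0"
  obtains f :: "'a::euclidean_space \<Rightarrow> 'a" and r where "f \<in> borel_measurable borel" "finite (range f)"
    "\<And>x y. dist (f x) (f y) \<le> dist x y + 2 / k"
    "\<And>x. norm x \<le> k \<Longrightarrow> dist (f x) x \<le> 1 / k"
    "r > 0" "\<And>x. x \<in> ball 0 r \<Longrightarrow> f x = 0"
proof -
  define e where "e = 1 / k"
  have e: "e > 0" using assms by (simp add: e_def)
  define P where "P = closest_point (cball (0::'a) k)"
  have ball: "convex (cball (0::'a) k)" "closed (cball (0::'a) k)" "cball (0::'a) k \<noteq> {}"
    using assms by auto
  have Pk: "P x \<in> cball 0 k" for x
    unfolding P_def by (intro closest_point_in_set ball)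
  have Pid: "P x = x" if "norm x \<le> k" for x
    unfolding P_def using that by (intro closest_point_self) auto
  have Plip: "dist (P x) (P y) \<le> dist x y" for x y
    unfolding P_def by (intro closest_point_lipschitz ball)
  have P [measurable]: "P \<in> borel_measurable borel"
    unfolding P_def by (intro borel_measurable_continuous_onI continuous_on_closest_point ball)
  obtain D where D: "finite D" "cball (0::'a) k \<subseteq> (\<Union>d\<in>D. ball d e)"
    using compact_eq_totally_bounded[of "cball (0::'a) k"] e by auto
  obtain g where g [measurable]: "g \<in> borel_measurable borel" and fin: "finite (range g)"
    and near: "\<And>x. x \<in> (\<Union>d\<in>D. ball d e) \<Longrightarrow> dist (g x) x < e"
    using finite_net_selector[OF D(1), of e] by blast
  define f where "f x = (if norm (P x) < e then 0 else g (P x))" for x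
  have f: "f \<in> borel_measurable borel" unfolding f_def by measurable
  have ffin: "finite (range f)"
    by (rule finite_subset[of _ "insert 0 (range g)"]) (auto simp: f_def fin)
  have fP: "dist (f x) (P x) \<le> e" for x
    using near[of "P x"] D(2) Pk[of x] by (auto simp: f_def less_imp_le subset_iff)
  have "dist (f x) (f y) \<le> dist x y + 2 / k" for x y
  proof -
    have "dist (f x) (f y) \<le> dist (f x) (P x) + dist (P x) (P y) + dist (P y) (f y)"
      using dist_triangle[of "f x" "f y" "P x"] dist_triangle[of "P x" "f y" "P y"] by linarith
    then show ?thesis
      using fP[of x] fP[of y] Plip[of x y] by (simp add: e_def dist_commute)
  qed
  moreover have "dist (f x) x \<le> 1 / k" if "norm x \<le> k" for x
    using fP[of x] Pid[OF that] by (simp add: e_def)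
  moreover have "f x = 0" if "x \<in> ball 0 (min e k)" for x
    using that Pid[of x] by (simp add: f_def)
  moreover have "min e k > 0" using e assms by simp
  ultimately show ?thesis using that[of f "min e k"] f ffin by blast
qed

text \<open>Round both coordinates to finite nets and decrease the distance by the rounding error. The result is
  a combination of indicators of rectangles, lies below the cost, and converges to it as the nets
  are refined. The sides of the rectangles are origin regular because the rounding is constant near \<open>0\<close>, and
  the only cell whose measure may not converge, the one at the origin, has weight \<open>0\<close>. So the rounded
  costs pass to the limit, and Fatou's lemma gives the claim.\<close>

lemma cost2_le_limit:
  fixes G :: "('a::euclidean_space \<times> 'a) measure" and H :: "'i \<Rightarrow> ('a \<times> 'a) measure"
  assumes sG: "sets G = sets borel" and sH: "\<And>i. sets (H i) = sets borel" and F: "F \<noteq> bot"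
    and rect: "\<And>A B. A \<in> origin_regular \<Longrightarrow> B \<in> origin_regular \<Longrightarrow> \<not> (0 \<in> A \<and> 0 \<in> B) \<Longrightarrow>
       ((\<lambda>i. emeasure (H i) (A \<times> B)) \<longlongrightarrow> emeasure G (A \<times> B)) F"
    and cost: "((\<lambda>i. cost2 (H i)) \<longlongrightarrow> L) F"
  shows "cost2 G \<le> L"
proof -
  define k where "k n = real (Suc n)" for n
  have k: "k n > 0" for n by (simp add: k_def)
  have "\<exists>f :: 'a \<Rightarrow> 'a. \<exists>r. f \<in> borel_measurable borel \<and> finite (range f) \<and>
    (\<forall>x y. dist (f x) (f y) \<le> dist x y + 2 / k n) \<and>
    (\<forall>x. norm x \<le> k n \<longrightarrow> dist (f x) x \<le> 1 / k n) \<and> r > 0 \<and> (\<forall>x. x \<in> ball 0 r \<longrightarrow> f x = 0)" for n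
    by (rule finite_range_approximation[OF k[of n]]) blast
  then obtain f :: "nat \<Rightarrow> 'a \<Rightarrow> 'a" and r where f [measurable]: "\<And>n. f n \<in> borel_measurable borel"
    and fin: "\<And>n. finite (range (f n))"
    and lip: "\<And>n x y. dist (f n x) (f n y) \<le> dist x y + 2 / k n"
    and near: "\<And>n x. norm x \<le> k n \<Longrightarrow> dist (f n x) x \<le> 1 / k n"
    and r: "\<And>n. r n > 0" "\<And>n x. x \<in> ball 0 (r n) \<Longrightarrow> f n x = 0"
    by metis
  \<comment> \<open>The subtraction of \<open>2 / k n\<close> compensates the error allowed by \<open>lip\<close>.\<close>
  define w where "w n u v = ennreal (1/2 * (max 0 (dist u v - 2 / k n))\<^sup>2)" for n and u v :: 'a
  define c where "c n z = w n (f n (fst z)) (f n (snd z))" for n z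
  define cell where "cell n u = f n -` {u}" for n u
  have cell: "cell n u \<in> origin_regular" for n u
    using r(1)[of n] r(2)[of _ n] measurable_sets_borel[OF f[of n], of "{u}"]
    by (intro origin_regularI[where r = "r n"]) (auto simp: cell_def)
  have zero: "u = 0" if "0 \<in> cell n u" for n u
    using that r(1)[of n] r(2)[of 0 n] by (auto simp: cell_def)
  have c_sum: "c n z = (\<Sum>u\<in>range (f n). \<Sum>v\<in>range (f n). w n u v * indicator (cell n u \<times> cell n v) z)" for n z
  proof -
    have "(\<Sum>u\<in>range (f n). \<Sum>v\<in>range (f n). w n u v * indicator (cell n u \<times> cell n v) z)
      = (\<Sum>u\<in>range (f n). \<Sum>v\<in>range (f n). if v = f n (snd z) then (if u = f n (fst z) then w n u v else 0) else 0)"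
      by (intro sum.cong refl) (auto simp: cell_def indicator_def mem_Times_iff)
    also have "\<dots> = c n z" by (simp add: fin c_def)
    finally show ?thesis by simp
  qed
  have c_int: "(\<integral>\<^sup>+z. c n z \<partial>K) = (\<Sum>u\<in>range (f n). \<Sum>v\<in>range (f n). w n u v * emeasure K (cell n u \<times> cell n v))"
    if sK: "sets K = sets borel" for n K
  proof -
    have [measurable]: "cell n u \<times> cell n v \<in> sets K" for u v
      using cell by (simp add: sK borel_Times origin_regular_borel)
    show ?thesis
      unfolding c_sum by (subst nn_integral_sum, measurable)+ (simp add: nn_integral_cmult_indicator)
  qed
  have c_le: "c n z \<le> ennreal (1/2 * (norm (fst z - snd z))\<^sup>2)" for n z
    unfolding c_def w_def using lip[of n "fst z" "snd z"]
    by (intro ennreal_leI mult_left_mono power_mono) (auto simp: dist_norm)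
  have c_lim: "(\<lambda>n. c n z) \<longlonglongrightarrow> ennreal (1/2 * (norm (fst z - snd z))\<^sup>2)" for z
  proof -
    have inv: "(\<lambda>n. 1 / k n) \<longlonglongrightarrow> 0"
      unfolding k_def using LIMSEQ_inverse_real_of_nat by (simp add: inverse_eq_divide)
    have flim: "(\<lambda>n. f n x) \<longlonglongrightarrow> x" for x
    proof (rule metric_tendsto_imp_tendsto[OF inv])
      have "\<forall>\<^sub>F n in sequentially. norm x \<le> k n"
        unfolding k_def using filterlim_compose[OF filterlim_real_sequentially filterlim_Suc]
        by (auto simp: filterlim_at_top)
      then show "\<forall>\<^sub>F n in sequentially. dist (f n x) x \<le> dist (1 / k n) 0"
        by eventually_elim (use near k in \<open>auto simp: less_imp_le\<close>)
    qed
    have "(\<lambda>n. 1/2 * (max 0 (dist (f n (fst z)) (f n (snd z)) - 2 * (1 / k n)))\<^sup>2)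
      \<longlonglongrightarrow> 1/2 * (max 0 (dist (fst z) (snd z) - 2 * 0))\<^sup>2"
      by (intro tendsto_intros flim inv)
    then show ?thesis unfolding c_def w_def by (intro tendsto_ennrealI) (simp add: dist_norm)
  qed
  have bound: "(\<integral>\<^sup>+z. c n z \<partial>G) \<le> L" for n
  proof (rule tendsto_le[OF F cost])
    show "((\<lambda>i. \<integral>\<^sup>+z. c n z \<partial>H i) \<longlongrightarrow> (\<integral>\<^sup>+z. c n z \<partial>G)) F"
      unfolding c_int[OF sG] c_int[OF sH]
    proof (intro tendsto_sum)
      fix u v
      show "((\<lambda>i. w n u v * emeasure (H i) (cell n u \<times> cell n v)) \<longlongrightarrow> w n u v * emeasure G (cell n u \<times> cell n v)) F"
      proof (cases "0 \<in> cell n u \<and> 0 \<in> cell n v")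
        case True
        then have "u = 0" "v = 0" using zero by auto
        then have "w n u v = 0" using k[of n] by (simp add: w_def)
        then show ?thesis by simp
      next
        case False
        then show ?thesis
          by (intro ennreal_tendsto_cmult rect cell) (auto simp: w_def)
      qed
    qed
    show "\<forall>\<^sub>F i in F. (\<integral>\<^sup>+z. c n z \<partial>H i) \<le> cost2 (H i)"
      unfolding cost2_def using c_le by (intro always_eventually allI nn_integral_mono) (simp add: split_beta)
  qed
  have "cost2 G = (\<integral>\<^sup>+z. liminf (\<lambda>n. c n z) \<partial>G)"
    unfolding cost2_def lim_imp_Liminf[OF sequentially_bot c_lim] case_prod_unfold ..
  also have "\<dots> \<le> liminf (\<lambda>n. \<integral>\<^sup>+z. c n z \<partial>G)"
  proof (rule nn_integral_liminf)
    fix n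
    have [measurable]: "cell n u \<times> cell n v \<in> sets G" for u v
      using cell by (simp add: sG borel_Times origin_regular_borel)
    show "c n \<in> borel_measurable G" unfolding c_sum[abs_def] by measurable
  qed
  also have "\<dots> \<le> limsup (\<lambda>n. \<integral>\<^sup>+z. c n z \<partial>G)"
    by (rule Liminf_le_Limsup) simp
  also have "\<dots> \<le> L"
    using bound by (intro Limsup_bounded always_eventually allI)
  finally show ?thesis .
qed

section \<open>Existence of optimal couplings\<close>

lemma levy_coupling_Lambda2:
  assumes "M \<in> Lambda2" "N \<in> Lambda2" "G \<in> levy_couplings M N"
  shows "G \<in> Lambda2"
proof -
  have levy: "levy_measure M" "levy_measure N" using assms by (simp_all add: Lambda2_def)
  have "(\<integral>\<^sup>+ z. ennreal ((norm z)\<^sup>2) \<partial>G) = (\<integral>\<^sup>+ z. ennreal ((norm (fst z))\<^sup>2) + ennreal ((norm (snd z))\<^sup>2) \<partial>G)"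
    by (simp add: norm_prod_squared)
  also have "\<dots> = (\<integral>\<^sup>+ x. ennreal ((norm x)\<^sup>2) \<partial>M) + (\<integral>\<^sup>+ x. ennreal ((norm x)\<^sup>2) \<partial>N)"
    using levy_couplings_marginals[OF assms(3)] levy_couplings_sets[OF assms(3)]
    by (intro nn_integral_levy_marginals[OF levy]) auto
  also have "\<dots> < \<infinity>" using assms by (simp add: Lambda2_def)
  finally show ?thesis
    using assms(3) by (simp add: Lambda2_def levy_couplings_def)
qed

lemma optimal_levy_coupling_exists:
  assumes levy: "levy_measure M" "levy_measure N"
  shows "\<exists>G. optimal_levy_coupling2 M N G"
proof -
  let ?I = "INF G \<in> levy_couplings M N. cost2 G"
  obtain a :: "nat \<Rightarrow> ennreal" where a: "decseq a" "range a \<subseteq> cost2 ` levy_couplings M N" "?I = (INF n. a n)"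
    using ennreal_Inf_countable_INF[of "cost2 ` levy_couplings M N"] levy_couplings_nonempty[OF levy] by auto
  have "\<exists>G. G \<in> levy_couplings M N \<and> cost2 G = a n" for n
    using a(2) by (metis (no_types, lifting) imageE rangeI subsetD)
  then obtain H where H: "\<And>n. H n \<in> levy_couplings M N" "\<And>n. cost2 (H n) = a n" by metis
  obtain F m where F: "F \<noteq> bot" "F \<le> sequentially"
    and m: "\<And>S. ((\<lambda>n. emeasure (H n) S) \<longlongrightarrow> m S) F"
    using pointwise_limit_along_subfilter[of "\<lambda>n S. emeasure (H n) S"] by metis
  obtain G where G: "G \<in> levy_couplings M N"
    and rect: "\<And>A B. A \<in> origin_regular \<Longrightarrow> B \<in> origin_regular \<Longrightarrow> \<not> (0 \<in> A \<and> 0 \<in> B) \<Longrightarrow>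
       emeasure G (A \<times> B) = m (A \<times> B)"
    using levy_coupling_of_content[OF levy coupling_content_limit[OF H(1) F(1) m]] by metis
  have "(\<lambda>n. cost2 (H n)) \<longlonglongrightarrow> ?I"
    using LIMSEQ_INF[OF a(1)] by (simp add: H(2) a(3))
  then have "((\<lambda>n. cost2 (H n)) \<longlongrightarrow> ?I) F" by (rule tendsto_mono[OF F(2)])
  then have "cost2 G \<le> ?I"
    using levy_couplings_sets[OF G] levy_couplings_sets[OF H(1)] F(1) m rect
    by (intro cost2_le_limit[of G H F]) auto
  then have "cost2 G = ?I" using G by (intro antisym INF_lower)
  then show ?thesis using G unfolding optimal_levy_coupling2_def by blast
qed

theorem theorem3p18:
  fixes \<mu> \<nu> :: "(real ^ 'd) measure"
  assumes "\<mu> \<in> Lambda2" and "\<nu> \<in> Lambda2"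
  shows "\<exists>\<gamma>. optimal_levy_coupling2 \<mu> \<nu> \<gamma> \<and> \<gamma> \<in> Lambda2"
proof -
  obtain \<gamma> where "optimal_levy_coupling2 \<mu> \<nu> \<gamma>"
    using optimal_levy_coupling_exists assms by (auto simp: Lambda2_def)
  then show ?thesis
    using levy_coupling_Lambda2 assms unfolding optimal_levy_coupling2_def by blast
qed

end
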